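(* Let $n\ge1$, let $P,Q\in\mathrm{GL}_n(\mathbb{C})$ be permutation matrices, and let $\omega(P),\omega(Q)\in\mathrm{S}_n$ denote the respective permutations. Then the following eight relations are all equivalent: 1. $\omega(Q)\le_{\mathrm{Bruhat}}\omega(P)$; 2. $P\diamond\mathbf{1}_{n\times n}\le_{\mathrm{Entry}}Q\diamond\mathbf{1}_{n\times n}$; 3. $\omega(\nabla_n)\,\omega(P)\le_{\mathrm{Bruhat}}\omega(\nabla_n)\,\omega(Q)$; 4. $(\nabla_nQ)\diamond\mathbf{1}_{n\times n}\le_{\mathrm{Entry}}(\nabla_nP)\diamond\mathbf{1}_{n\times n}$; 5. $\omega(P)\,\omega(\nabla_n)\le_{\mathrm{Bruhat}}\omega(Q)\,\omega(\nabla_n)$; 6. $(Q\nabla_n)\diamond\mathbf{1}_{n\times n}\le_{\mathrm{Entry}}(P\nabla_n)\diamond\mathbf{1}_{n\times n}$; 7. $\omega(Q)^{-1}\le_{\mathrm{Bruhat}}\omega(P)^{-1}$; 8. $P^T\diamond\mathbf{1}_{n\times n}\le_{\mathrm{Entry}}Q^T\diamond\mathbf{1}_{n\times n}$.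
   Context: Matrices are indexed by $(i,j)$ with $0\le i,j\le n-1$. The convolution (Jury product) of $A=(a_{ij}),B=(b_{ij})\in\mathbb{C}^{n\times n}$ is $(A\diamond B)_{ij}:=\sum_{\ell=0}^i\sum_{\kappa=0}^j a_{\ell,\kappa}b_{i-\ell,j-\kappa}$. $\mathbf{1}_{n\times n}$ is the $n\times n$ matrix with all entries $1$; $\nabla_n$ is the $n\times n$ anti-diagonal permutation matrix, so that $\omega(\nabla_n)=n\,(n-1)\cdots2\,1$ is the longest element of $\mathrm{S}_n$; $\le_{\mathrm{Entry}}$ is entrywise comparison of real matrices. $\le_{\mathrm{Bruhat}}$ is the (strong) Bruhat order on the symmetric group $\mathrm{S}_n$: the reflexive-transitive closure of the relations $u<ut$ where $t$ is a transposition and $ut$ has more inversions than $u$. The permutation $\omega(P)$ of a permutation matrix $P$ is given by $P_{i,j}=1$ iff $\omega(P)(i+1)=j+1$; products in $\mathrm{S}_n$ are compositions. *)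

theory Defs
  imports "Jordan_Normal_Form.Matrix" "HOL-Combinatorics.Permutations"
begin

text \<open>
  Matrices are indexed from 0. The symmetric group \<open>S\<^sub>n\<close> is the set of functions
  \<open>p :: nat \<Rightarrow> nat\<close> with \<open>p permutes {1..n}\<close>; its product is \<open>(\<circ>)\<close>.
  Entrywise comparison is the library order \<open>(\<le>)\<close> on complex matrices. It compares entries by
  the order of Complex_Order, i.e. real parts are compared and imaginary parts have to agree,
  so it is the usual entrywise order on matrices with real entries.
\<close>

definition jury_product :: "complex mat \<Rightarrow> complex mat \<Rightarrow> complex mat" (infixl "\<diamondop>" 70) where
  "A \<diamondop> B = mat (dim_row A) (dim_col A)
     (\<lambda>(i, j). \<Sum>l\<le>i. \<Sum>k\<le>j. A $$ (l, k) * B $$ (i - l, j - k))"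

definition ones_mat :: "nat \<Rightarrow> complex mat" where
  "ones_mat n = mat n n (\<lambda>_. 1)"

definition antidiag_mat :: "nat \<Rightarrow> complex mat" where
  "antidiag_mat n = mat n n (\<lambda>(i, j). if i + j = n - 1 then 1 else 0)"

definition permutation_mat :: "nat \<Rightarrow> complex mat \<Rightarrow> bool" where
  "permutation_mat n P \<longleftrightarrow> P \<in> carrier_mat n n
     \<and> (\<forall>i<n. \<forall>j<n. P $$ (i, j) = 0 \<or> P $$ (i, j) = 1)
     \<and> (\<forall>i<n. \<exists>!j. j < n \<and> P $$ (i, j) = 1)
     \<and> (\<forall>j<n. \<exists>!i. i < n \<and> P $$ (i, j) = 1)"

text \<open>
  The permutation of \<open>{1..n}\<close> given by an \<open>n \<times> n\<close> permutation matrix, extended by the identity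
  outside \<open>{1..n}\<close>; see \<open>mat_perm_iff\<close> for the defining property.
\<close>

definition mat_perm :: "complex mat \<Rightarrow> nat \<Rightarrow> nat" where
  "mat_perm P k = (if k \<in> {1..dim_row P}
     then (THE l. l \<in> {1..dim_col P} \<and> P $$ (k - 1, l - 1) = 1) else k)"

definition inversions :: "nat \<Rightarrow> (nat \<Rightarrow> nat) \<Rightarrow> nat" where
  "inversions n u = card {(i, j). 1 \<le> i \<and> i < j \<and> j \<le> n \<and> u j < u i}"

definition bruhat_step :: "nat \<Rightarrow> (nat \<Rightarrow> nat) \<Rightarrow> (nat \<Rightarrow> nat) \<Rightarrow> bool" where
  "bruhat_step n u v \<longleftrightarrow> u permutes {1..n}
     \<and> (\<exists>a\<in>{1..n}. \<exists>b\<in>{1..n}. a \<noteq> b \<and> v = u \<circ> Transposition.transpose a b)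
     \<and> inversions n u < inversions n v"

definition bruhat_le :: "nat \<Rightarrow> (nat \<Rightarrow> nat) \<Rightarrow> (nat \<Rightarrow> nat) \<Rightarrow> bool" where
  "bruhat_le n u v \<longleftrightarrow> u permutes {1..n} \<and> (bruhat_step n)\<^sup>*\<^sup>* u v"

definition all_equivalent :: "bool list \<Rightarrow> bool" where
  "all_equivalent Rs \<longleftrightarrow> (\<forall>R\<in>set Rs. \<forall>R'\<in>set Rs. R \<longleftrightarrow> R')"

lemma mat_perm_props:
  assumes P: "permutation_mat n P" and k: "k \<in> {1..n}"
  shows "mat_perm P k \<in> {1..n} \<and> P $$ (k - 1, mat_perm P k - 1) = 1"
    and "l \<in> {1..n} \<Longrightarrow> P $$ (k - 1, l - 1) = 1 \<Longrightarrow> mat_perm P k = l"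
proof -
  have dims: "dim_row P = n" "dim_col P = n"
    using P unfolding permutation_mat_def by (meson carrier_matD)+
  have "k - 1 < n" using k by auto
  then have "\<exists>!j. j < n \<and> P $$ (k - 1, j) = 1"
    using P by (simp only: permutation_mat_def)
  then obtain j where j: "j < n" "P $$ (k - 1, j) = 1"
      and uniq: "\<And>j'. j' < n \<Longrightarrow> P $$ (k - 1, j') = 1 \<Longrightarrow> j' = j"
    by metis
  have "(THE l. l \<in> {1..n} \<and> P $$ (k - 1, l - 1) = 1) = Suc j"
  proof (rule the_equality)
    show "Suc j \<in> {1..n} \<and> P $$ (k - 1, Suc j - 1) = 1" using j by simp
    show "l = Suc j" if "l \<in> {1..n} \<and> P $$ (k - 1, l - 1) = 1" for l
      using that uniq[of "l - 1"] by auto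
  qed
  then have "mat_perm P k = Suc j"
    using k by (simp add: mat_perm_def dims)
  then show "mat_perm P k \<in> {1..n} \<and> P $$ (k - 1, mat_perm P k - 1) = 1"
    and "l \<in> {1..n} \<Longrightarrow> P $$ (k - 1, l - 1) = 1 \<Longrightarrow> mat_perm P k = l"
    using j uniq[of "l - 1"] by auto
qed

lemma mat_perm_iff:
  assumes "permutation_mat n P" "i < n" "j < n"
  shows "P $$ (i, j) = 1 \<longleftrightarrow> mat_perm P (i + 1) = j + 1"
proof
  show "mat_perm P (i + 1) = j + 1" if "P $$ (i, j) = 1"
    by (rule mat_perm_props(2)[OF assms(1)]) (use assms(2,3) that in simp_all)
  show "P $$ (i, j) = 1" if "mat_perm P (i + 1) = j + 1"
    using mat_perm_props(1)[OF assms(1), of "i + 1"] assms(2) unfolding that by simp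
qed

lemma mat_perm_permutes:
  assumes P: "permutation_mat n P"
  shows "mat_perm P permutes {1..n}"
proof (rule bij_imp_permutes)
  have "inj_on (mat_perm P) {1..n}"
  proof (rule inj_onI)
    fix a b assume ab: "a \<in> {1..n}" "b \<in> {1..n}" "mat_perm P a = mat_perm P b"
    have "a - 1 < n" "b - 1 < n" "mat_perm P a - 1 < n"
      using ab mat_perm_props(1)[OF P, of a] by auto
    moreover have "P $$ (a - 1, mat_perm P a - 1) = 1" "P $$ (b - 1, mat_perm P a - 1) = 1"
      using ab mat_perm_props(1)[OF P, of a] mat_perm_props(1)[OF P, of b] by auto
    moreover have "\<exists>!i. i < n \<and> P $$ (i, mat_perm P a - 1) = 1"
      using P \<open>mat_perm P a - 1 < n\<close> by (simp only: permutation_mat_def)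
    ultimately have "a - 1 = b - 1"
      by metis
    then show "a = b" using ab by auto
  qed
  moreover have "mat_perm P ` {1..n} \<subseteq> {1..n}"
    using mat_perm_props(1)[OF P] by blast
  ultimately show "bij_betw (mat_perm P) {1..n} {1..n}"
    by (simp add: bij_betw_def endo_inj_surj)
  have "dim_row P = n"
    using P unfolding permutation_mat_def by (meson carrier_matD(1))
  then show "mat_perm P x = x" if "x \<notin> {1..n}" for x
    using that by (auto simp: mat_perm_def)
qed

lemma permutation_mat_antidiag: "permutation_mat n (antidiag_mat n)"
proof -
  have "\<exists>!j. j < n \<and> antidiag_mat n $$ (i, j) = 1" if "i < n" for i
    using that by (intro ex1I[of _ "n - 1 - i"]) (auto simp: antidiag_mat_def split: if_splits)
  moreover have "\<exists>!i. i < n \<and> antidiag_mat n $$ (i, j) = 1" if "j < n" for j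
    using that by (intro ex1I[of _ "n - 1 - j"]) (auto simp: antidiag_mat_def split: if_splits)
  moreover have "antidiag_mat n \<in> carrier_mat n n"
    and "\<forall>i<n. \<forall>j<n. antidiag_mat n $$ (i, j) = 0 \<or> antidiag_mat n $$ (i, j) = 1"
    by (simp_all add: antidiag_mat_def)
  ultimately show ?thesis
    unfolding permutation_mat_def by (intro conjI allI impI) simp_all
qed

lemma mat_perm_antidiag:
  assumes "k \<in> {1..n}"
  shows "mat_perm (antidiag_mat n) k = n + 1 - k"
  using assms by (intro mat_perm_props(2)[OF permutation_mat_antidiag]) (auto simp: antidiag_mat_def)

end

theory Submission
  imports Defs
begin

text \<open>
  Both sides of each relation are read off from the rank function
  \<open>r\<^sub>u(i, j) = #{x \<le> i. u x \<le> j}\<close>: the matrix \<open>P \<diamondop> \<one>\<close> tabulates \<open>r\<^sub>u\<close> for \<open>u = \<omega>(P)\<close>,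
  and \<open>u \<le> v\<close> in Bruhat order iff \<open>r\<^sub>v \<le> r\<^sub>u\<close> pointwise. A Bruhat step can only decrease \<open>r\<close>.
  Conversely, if \<open>r\<^sub>v \<le> r\<^sub>u\<close> and \<open>u \<noteq> v\<close>, take the first \<open>a\<close> with \<open>u a \<noteq> v a\<close> and then the
  least \<open>b > a\<close> with \<open>u a < u b \<le> v a\<close>; swapping the values at \<open>a\<close> and \<open>b\<close> is a Bruhat step
  that keeps \<open>r\<close> above \<open>r\<^sub>v\<close>. The symmetries follow because reversing values or positions
  complements \<open>r\<close>, and inversion transposes it.
\<close>

definition perm_rank :: "(nat \<Rightarrow> nat) \<Rightarrow> nat \<Rightarrow> nat \<Rightarrow> nat" where
  "perm_rank u i j = card {x \<in> {1..i}. u x \<le> j}"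

text \<open>Ranks and permutations are ordered oppositely. Including index 0, where the ranks of
  permutations vanish, makes the index range closed under \<open>j \<mapsto> n - j\<close>.\<close>

definition rank_le :: "nat \<Rightarrow> (nat \<Rightarrow> nat) \<Rightarrow> (nat \<Rightarrow> nat) \<Rightarrow> bool" where
  "rank_le n u v \<longleftrightarrow> (\<forall>i\<le>n. \<forall>j\<le>n. perm_rank v i j \<le> perm_rank u i j)"

section \<open>Inversions and the shape of a Bruhat step\<close>

lemma finite_inversion_set: "finite {(i, j). 1 \<le> i \<and> i < j \<and> j \<le> n \<and> u j < u i}"
  for u :: "nat \<Rightarrow> nat"
  by (rule finite_subset[of _ "{1..n} \<times> {1..n::nat}"]) auto

lemma inversions_le: "inversions n u \<le> n * n"
proof -
  have "inversions n u \<le> card ({1..n} \<times> {1..n})"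
    unfolding inversions_def by (intro card_mono) auto
  then show ?thesis by simp
qed

text \<open>With \<open>t\<close> the transposition, the inversions of \<open>u\<close> inject into
  those of \<open>u \<circ> t\<close>: move a pair by \<open>t\<close> if this keeps it increasing,
  otherwise leave it alone. The inversion \<open>(a, b)\<close> of \<open>u \<circ> t\<close> is
  never hit.\<close>

lemma inversions_transpose_less:
  assumes ab: "1 \<le> a" "a < b" "b \<le> n" and less: "u a < u b"
  shows "inversions n u < inversions n (u \<circ> Transposition.transpose a b)"
proof -
  define t where "t = Transposition.transpose a b"
  define inv_set where "inv_set w = {(i, j). 1 \<le> i \<and> i < j \<and> j \<le> n \<and> w j < (w i :: nat)}"
    for w :: "nat \<Rightarrow> nat"
  define f where "f = (\<lambda>(i, j). if t i < t j then (t i, t j) else (i, j))"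
  have t: "t a = b" "t b = a" "\<And>x. x \<noteq> a \<Longrightarrow> x \<noteq> b \<Longrightarrow> t x = x"
    by (simp_all add: t_def)
  have tt: "t (t x) = x" for x
    by (simp add: t_def)
  have t_inj: "t x = t y \<longleftrightarrow> x = y" for x y
    using tt by metis
  \<comment> \<open>A moved pair stays increasing when \<open>t\<close> is applied to it again, a
    kept pair does not, so the two kinds of image cannot collide.\<close>
  have "inj_on f (inv_set u)"
  proof (rule inj_onI)
    fix p q assume "p \<in> inv_set u" "q \<in> inv_set u" "f p = f q"
    then show "p = q"
      unfolding inv_set_def f_def by (auto split: if_splits simp: tt t_inj)
  qed
  moreover have "f p \<in> inv_set (u \<circ> t) - {(a, b)}" if p: "p \<in> inv_set u" for p
  proof -
    obtain i j where ij: "p = (i, j)" "1 \<le> i" "i < j" "j \<le> n" "u j < u i"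
      using p unfolding inv_set_def by auto
    show ?thesis
    proof (cases "t i < t j")
      case True
      have "1 \<le> t i" "t j \<le> n"
        using t ij ab by (metis less_imp_le_nat order_trans)+
      moreover have "(t i, t j) \<noteq> (a, b)"
        using tt t ij ab by (metis less_asym prod.inject)
      ultimately show ?thesis
        using True ij unfolding f_def inv_set_def by (auto simp: tt)
    next
      case False
      \<comment> \<open>Only pairs with end \<open>a\<close> or \<open>b\<close> get reversed, and
        \<open>(a, b)\<close> itself is not an inversion of \<open>u\<close>. The pair that is kept
        then remains an inversion because \<open>u a < u b\<close>.\<close>
      then have "i = a \<and> j \<noteq> b \<or> j = b \<and> i \<noteq> a"
        using t ij less ab by (metis less_asym less_trans)
      then show ?thesis
        using False ij t less unfolding f_def inv_set_def by auto
    qed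
  qed
  ultimately have "card (inv_set u) \<le> card (inv_set (u \<circ> t) - {(a, b)})"
    using finite_inversion_set[where u = "u \<circ> t"]
    by (intro card_inj_on_le[of f] image_subsetI finite_Diff) (simp_all only: inv_set_def)
  also have "\<dots> < card (inv_set (u \<circ> t))"
  proof (rule card_Diff1_less)
    show "finite (inv_set (u \<circ> t))"
      unfolding inv_set_def by (rule finite_inversion_set)
    show "(a, b) \<in> inv_set (u \<circ> t)"
      unfolding inv_set_def using ab less t(1,2) by simp
  qed
  finally show ?thesis
    unfolding inversions_def inv_set_def t_def .
qed

text \<open>Since \<open>u\<close> is injective, the alternative to \<open>u a < u b\<close> is
  \<open>v a < v b\<close>; then swapping back from \<open>v\<close> to \<open>u\<close> would raise
  the number of inversions as well.\<close>

lemma bruhat_step_iff: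
  "bruhat_step n u v \<longleftrightarrow> u permutes {1..n} \<and>
     (\<exists>a b. 1 \<le> a \<and> a < b \<and> b \<le> n \<and> u a < u b \<and> v = u \<circ> Transposition.transpose a b)"
proof
  assume step: "bruhat_step n u v"
  then have u: "u permutes {1..n}" by (simp add: bruhat_step_def)
  obtain a' b' where ab': "a' \<in> {1..n}" "b' \<in> {1..n}" "a' \<noteq> b'"
    "v = u \<circ> Transposition.transpose a' b'" and inv: "inversions n u < inversions n v"
    using step by (auto simp: bruhat_step_def)
  define a b where "a = min a' b'" and "b = max a' b'"
  have ab: "1 \<le> a" "a < b" "b \<le> n" "v = u \<circ> Transposition.transpose a b"
    using ab' by (auto simp: a_def b_def min_def max_def transpose_commute)
  have "u a < u b"
  proof (rule ccontr)
    assume "\<not> u a < u b"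
    moreover have "u a \<noteq> u b"
      using ab permutes_inj[OF u] by (metis inj_eq less_irrefl)
    ultimately have "v a < v b" by (simp add: ab(4))
    then have "inversions n v < inversions n (v \<circ> Transposition.transpose a b)"
      using ab by (intro inversions_transpose_less) auto
    also have "v \<circ> Transposition.transpose a b = u" by (simp add: ab(4) comp_assoc)
    finally show False using inv by simp
  qed
  with u ab show "u permutes {1..n} \<and>
     (\<exists>a b. 1 \<le> a \<and> a < b \<and> b \<le> n \<and> u a < u b \<and> v = u \<circ> Transposition.transpose a b)"
    by blast
next
  assume "u permutes {1..n} \<and>
     (\<exists>a b. 1 \<le> a \<and> a < b \<and> b \<le> n \<and> u a < u b \<and> v = u \<circ> Transposition.transpose a b)"
  then obtain a b where "u permutes {1..n}" "1 \<le> a" "a < b" "b \<le> n" "u a < u b"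
    "v = u \<circ> Transposition.transpose a b" by blast
  then show "bruhat_step n u v"
    unfolding bruhat_step_def using inversions_transpose_less[of a b n u]
    by (intro conjI bexI[of _ a] bexI[of _ b]) auto
qed

section \<open>From Bruhat order to ranks\<close>

text \<open>Inject the positions counted after the swap into those counted before: apply the
  transposition unless it leaves \<open>{1..i}\<close>. In that case the position is
  \<open>a\<close> with \<open>b > i\<close>, and it may stay because
  \<open>u a < u b \<le> j\<close>.\<close>

lemma perm_rank_transpose_le:
  assumes "1 \<le> a" "a < b" "u a < u b"
  shows "perm_rank (u \<circ> Transposition.transpose a b) i j \<le> perm_rank u i j"
proof -
  define t where "t = Transposition.transpose a b"
  define f where "f x = (if t x \<le> i then t x else x)" for x
  have t: "t a = b" "t b = a" "\<And>x. x \<noteq> a \<Longrightarrow> x \<noteq> b \<Longrightarrow> t x = x"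
    by (simp_all add: t_def)
  have tt: "t (t x) = x" for x
    by (simp add: t_def)
  have "inj_on f {x \<in> {1..i}. (u \<circ> t) x \<le> j}"
    by (rule inj_onI) (auto simp: f_def tt split: if_splits dest: arg_cong[of _ _ t])
  moreover have "f x \<in> {x \<in> {1..i}. u x \<le> j}" if "x \<in> {x \<in> {1..i}. (u \<circ> t) x \<le> j}" for x
    using that assms t by (cases "x = a"; cases "x = b") (auto simp: f_def)
  ultimately show ?thesis
    unfolding perm_rank_def t_def[symmetric]
    by (intro card_inj_on_le[of f]) auto
qed

lemma bruhat_step_permutes:
  assumes "bruhat_step n u v"
  shows "v permutes {1..n}"
proof -
  obtain a b where "u permutes {1..n}" "1 \<le> a" "a < b" "b \<le> n"
    "v = u \<circ> Transposition.transpose a b"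
    using assms unfolding bruhat_step_iff by blast
  then show ?thesis
    using permutes_compose[OF permutes_swap_id[of a "{1..n}" b]] by simp
qed

lemma bruhat_le_imp_rank_le:
  assumes "bruhat_le n u v"
  shows "rank_le n u v"
proof -
  have "(bruhat_step n)\<^sup>*\<^sup>* u v" using assms by (simp add: bruhat_le_def)
  then show ?thesis
  proof induction
    case base
    show ?case by (simp add: rank_le_def)
  next
    case (step v w)
    obtain a b where "1 \<le> a" "a < b" "v a < v b" "w = v \<circ> Transposition.transpose a b"
      using step.hyps unfolding bruhat_step_iff by blast
    then have "perm_rank w i j \<le> perm_rank v i j" for i j
      using perm_rank_transpose_le by blast
    with step.IH show ?case unfolding rank_le_def by (meson order_trans)
  qed
qed

section \<open>From ranks to Bruhat order\<close>

lemma perm_rank_split: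
  assumes "j \<le> k"
  shows "perm_rank u i k = perm_rank u i j + card {x \<in> {1..i}. j < u x \<and> u x \<le> k}"
proof -
  have "{x \<in> {1..i}. u x \<le> k} = {x \<in> {1..i}. u x \<le> j} \<union> {x \<in> {1..i}. j < u x \<and> u x \<le> k}"
    using assms by auto
  then show ?thesis
    unfolding perm_rank_def by (simp only:) (intro card_Un_disjoint; auto)
qed

text \<open>Compare ranks at \<open>(a, v a)\<close>: positions before \<open>a\<close> contribute
  equally, so if \<open>v a < u a\<close>, only \<open>v\<close> counts \<open>a\<close> and its
  rank would be larger.\<close>

lemma rank_le_first_difference:
  assumes le: "rank_le n u v" and v: "v permutes {1..n}"
    and a: "a \<in> {1..n}" and agree: "\<And>x. x < a \<Longrightarrow> u x = v x"
  shows "u a \<le> v a"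
proof (rule ccontr)
  assume contr: "\<not> u a \<le> v a"
  have "v a \<in> {1..n}" using a unfolding permutes_in_image[OF v] .
  then have "perm_rank v a (v a) \<le> perm_rank u a (v a)"
    using le a by (simp add: rank_le_def)
  moreover have "perm_rank u a (v a) < perm_rank v a (v a)"
    unfolding perm_rank_def
  proof (rule psubset_card_mono)
    have "{x \<in> {1..a}. u x \<le> v a} \<subseteq> {x \<in> {1..a}. v x \<le> v a}"
      using agree contr by (auto simp: le_less)
    moreover have "a \<in> {x \<in> {1..a}. v x \<le> v a}" "a \<notin> {x \<in> {1..a}. u x \<le> v a}"
      using a contr by auto
    ultimately show "{x \<in> {1..a}. u x \<le> v a} \<subset> {x \<in> {1..a}. v x \<le> v a}" by blast
  qed simp
  ultimately show False by simp
qed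

text \<open>If \<open>b \<le> i\<close>, the transposition permutes \<open>{1..i}\<close>. If
  \<open>i < b\<close>, at most \<open>a\<close> of the two positions is counted, and when it lies
  in \<open>{1..i}\<close> both \<open>u a\<close> and \<open>u b\<close> are on the same side of
  \<open>j\<close>.\<close>

lemma perm_rank_transpose_eq:
  assumes ab: "1 \<le> a" "a < b" and outside: "i < a \<or> b \<le> i \<or> j < u a \<or> u b \<le> j" and less: "u a < u b"
  shows "perm_rank (u \<circ> Transposition.transpose a b) i j = perm_rank u i j"
proof -
  define t where "t = Transposition.transpose a b"
  have t: "t a = b" "t b = a" "\<And>x. x \<noteq> a \<Longrightarrow> x \<noteq> b \<Longrightarrow> t x = x"
    by (simp_all add: t_def)
  consider "b \<le> i" | "i < b" "i < a \<or> j < u a \<or> u b \<le> j"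
    using outside by linarith
  then show ?thesis
  proof cases
    case 1
    have *: "t x \<in> {1..i} \<longleftrightarrow> x \<in> {1..i}" for x
      using 1 ab by (auto simp: t_def Transposition.transpose_def)
    have tt: "t (t x) = x" for x
      by (simp add: t_def)
    have "bij_betw t {x \<in> {1..i}. (u \<circ> t) x \<le> j} {x \<in> {1..i}. u x \<le> j}"
    proof (rule bij_betw_byWitness[where f' = t])
      show "t ` {x \<in> {1..i}. (u \<circ> t) x \<le> j} \<subseteq> {x \<in> {1..i}. u x \<le> j}"
        and "t ` {x \<in> {1..i}. u x \<le> j} \<subseteq> {x \<in> {1..i}. (u \<circ> t) x \<le> j}"
        by (intro image_subsetI; simp only: mem_Collect_eq * comp_apply tt)+
    qed (simp_all add: tt)
    then show ?thesis
      unfolding perm_rank_def t_def[symmetric] by (rule bij_betw_same_card)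
  next
    case 2
    have "(u \<circ> t) x \<le> j \<longleftrightarrow> u x \<le> j" if "x \<in> {1..i}" for x
      using that 2 t less by (cases "x = a"; cases "x = b") auto
    then have "{x \<in> {1..i}. (u \<circ> t) x \<le> j} = {x \<in> {1..i}. u x \<le> j}"
      by blast
    then show ?thesis unfolding perm_rank_def t_def[symmetric] by simp
  qed
qed

text \<open>Inside the rectangle \<open>b\<close> lies beyond \<open>i\<close>, and the value at
  \<open>a\<close> rises from at most \<open>j\<close> to above \<open>j\<close>, so exactly the
  position \<open>a\<close> is lost.\<close>

lemma perm_rank_transpose_Suc:
  assumes "1 \<le> a" "a \<le> i" "i < b" "u a \<le> j" "j < u b"
  shows "Suc (perm_rank (u \<circ> Transposition.transpose a b) i j) = perm_rank u i j"
proof -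
  have "{x \<in> {1..i}. u x \<le> j}
      = insert a {x \<in> {1..i}. (u \<circ> Transposition.transpose a b) x \<le> j}"
    using assms by (auto simp: Transposition.transpose_def split: if_splits)
  moreover have "a \<notin> {x \<in> {1..i}. (u \<circ> Transposition.transpose a b) x \<le> j}"
    using assms by simp
  ultimately show ?thesis unfolding perm_rank_def by simp
qed

text \<open>The swap costs one unit of rank, and only on the rectangle \<open>a \<le> i < b\<close>,
  \<open>u a \<le> j < u b\<close>. It is affordable because leastness of \<open>b\<close> forces
  the rank of \<open>v\<close> to be strictly smaller than that of \<open>u\<close> there.\<close>

lemma rank_le_step:
  assumes u: "u permutes {1..n}" and v: "v permutes {1..n}"
    and le: "rank_le n u v" and ne: "u \<noteq> v"
  shows "\<exists>w. bruhat_step n u w \<and> rank_le n w v"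
proof -
  define a where "a = (LEAST x. u x \<noteq> v x)"
  have "\<exists>x. u x \<noteq> v x" using ne by auto
  then have ua: "u a \<noteq> v a"
    unfolding a_def by (rule LeastI_ex)
  have agree: "u x = v x" if "x < a" for x
    using that not_less_Least unfolding a_def by blast
  have an: "a \<in> {1..n}"
    using ua u v by (metis permutes_not_in)
  have "u a \<le> v a"
    by (rule rank_le_first_difference[OF le v an agree])
  then have less: "u a < v a" using ua by simp
  define B where "B x \<longleftrightarrow> a < x \<and> u a < u x \<and> u x \<le> v a" for x
  \<comment> \<open>A candidate exists: the position where \<open>u\<close> takes the value
    \<open>v a\<close>. It cannot precede \<open>a\<close>, since \<open>u\<close> and
    \<open>v\<close> agree there and \<open>v\<close> is injective.\<close>
  obtain c where c: "u c = v a"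
    using permutes_surj[OF u] by (metis surjD)
  have "\<not> c < a" "c \<noteq> a"
    using agree[of c] c ua permutes_inj[OF v] by (auto dest: injD)
  then have "B c" using c less by (simp add: B_def)
  define b where "b = (LEAST x. B x)"
  have "B b" unfolding b_def using \<open>B c\<close> by (rule LeastI)
  then have b: "a < b" "u a < u b" "u b \<le> v a" by (simp_all add: B_def)
  have least: "\<not> B x" if "x < b" for x
    using that not_less_Least unfolding b_def by blast
  have "v a \<in> {1..n}" using an unfolding permutes_in_image[OF v] .
  \<comment> \<open>Otherwise \<open>u\<close> fixes \<open>b\<close>, so
    \<open>u b = b > n\<close>, against \<open>u b \<le> v a \<le> n\<close>.\<close>
  then have "b \<le> n"
    using b u an by (metis atLeastAtMost_iff le_trans linorder_not_le order_less_imp_le permutes_not_in)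
  define w where "w = u \<circ> Transposition.transpose a b"
  have "bruhat_step n u w"
    unfolding bruhat_step_iff w_def using u an b \<open>b \<le> n\<close> by auto
  moreover have "perm_rank v i j \<le> perm_rank w i j" if ij: "i \<le> n" "j \<le> n" for i j
  proof (cases "i < a \<or> b \<le> i \<or> j < u a \<or> u b \<le> j")
    case True
    then have "perm_rank w i j = perm_rank u i j"
      unfolding w_def using an b by (intro perm_rank_transpose_eq) auto
    then show ?thesis using le ij by (simp add: rank_le_def)
  next
    case False
    then have in_range: "a \<le> i" "i < b" "u a \<le> j" "j < u b" by auto
    have "Suc (perm_rank w i j) = perm_rank u i j"
      unfolding w_def using an in_range by (intro perm_rank_transpose_Suc) auto
    \<comment> \<open>Count the values in the interval from \<open>j + 1\<close> to
      \<open>v a\<close> at positions up to \<open>i\<close>. For \<open>u\<close> they occur only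
      before \<open>a\<close>, by leastness of \<open>b\<close>, and \<open>v\<close> has the same
      ones there; but \<open>v\<close> also has \<open>v a\<close> at \<open>a\<close>. Subtracting
      from the ranks at column \<open>v a\<close> gives strictness at \<open>j\<close>.\<close>
    moreover have "perm_rank v i j < perm_rank u i j"
    proof -
      let ?U = "{x \<in> {1..i}. j < u x \<and> u x \<le> v a}" and ?V = "{x \<in> {1..i}. j < v x \<and> v x \<le> v a}"
      have below: "x < a" if "x \<in> ?U" for x
      proof -
        have "x \<noteq> a" using that in_range by auto
        moreover have "\<not> a < x" using that in_range least[of x] by (auto simp: B_def)
        ultimately show ?thesis by linarith
      qed
      then have "?U \<subseteq> ?V"
      proof (intro subsetI)
        fix x assume x: "x \<in> ?U"
        have "u x = v x" by (rule agree[OF below[OF x]])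
        then show "x \<in> ?V" using x by simp
      qed
      moreover have "a \<in> ?V" "a \<notin> ?U"
        using an in_range b by auto
      ultimately have "card ?U < card ?V"
        by (intro psubset_card_mono) auto
      moreover have "perm_rank v i (v a) \<le> perm_rank u i (v a)"
        using le ij \<open>v a \<in> {1..n}\<close> by (simp add: rank_le_def)
      ultimately show ?thesis
        using perm_rank_split[of j "v a" u i] perm_rank_split[of j "v a" v i] in_range b by simp
    qed
    ultimately show ?thesis by simp
  qed
  ultimately show ?thesis unfolding rank_le_def by blast
qed

text \<open>Iterate \<open>rank_le_step\<close>. Each step adds inversions, whose number is at most
  \<open>n * n\<close>, so the chain must reach \<open>v\<close>.\<close>

lemma rank_le_imp_bruhat_le:
  assumes "u permutes {1..n}" "v permutes {1..n}" "rank_le n u v"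
  shows "bruhat_le n u v"
  using assms
proof (induction "n * n - inversions n u" arbitrary: u rule: less_induct)
  case less
  show ?case
  proof (cases "u = v")
    case True
    then show ?thesis using less.prems by (simp add: bruhat_le_def)
  next
    case False
    then obtain w where w: "bruhat_step n u w" "rank_le n w v"
      using rank_le_step less.prems by blast
    have "inversions n u < inversions n w" using w by (simp add: bruhat_step_def)
    then have "n * n - inversions n w < n * n - inversions n u"
      using inversions_le[of n w] by linarith
    then have "bruhat_le n w v"
      using less.hyps bruhat_step_permutes[OF w(1)] less.prems w(2) by blast
    then show ?thesis
      using w(1) less.prems by (auto simp: bruhat_le_def intro: converse_rtranclp_into_rtranclp)
  qed
qed

lemma bruhat_le_iff_rank_le:
  assumes "u permutes {1..n}" "v permutes {1..n}"
  shows "bruhat_le n u v \<longleftrightarrow> rank_le n u v"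
  using assms bruhat_le_imp_rank_le rank_le_imp_bruhat_le by blast

section \<open>Ranks under inversion and reversal\<close>

text \<open>\<open>u\<close> carries the positions counted on the right bijectively onto those
  counted on the left.\<close>

lemma perm_rank_inv:
  assumes u: "u permutes {1..n}"
  shows "perm_rank (Hilbert_Choice.inv u) i j = perm_rank u j i"
proof -
  \<comment> \<open>Positions start at 1 while the bounds on values admit 0, so \<open>u\<close>
    must send no positive number to 0 and no other number than 0 to it.\<close>
  have zero: "u x = 0 \<longleftrightarrow> x = 0" for x
  proof -
    have "u 0 = 0" by (rule permutes_not_in[OF u]) simp
    then show ?thesis using permutes_inj[OF u] by (metis injD)
  qed
  have "u ` {x \<in> {1..j}. u x \<le> i} = {y \<in> {1..i}. Hilbert_Choice.inv u y \<le> j}"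
  proof (intro Set.set_eqI iffI)
    fix y assume y: "y \<in> {y \<in> {1..i}. Hilbert_Choice.inv u y \<le> j}"
    have "u (Hilbert_Choice.inv u y) = y" using permutes_inverses(1)[OF u] .
    then show "y \<in> u ` {x \<in> {1..j}. u x \<le> i}"
      using y zero[of "Hilbert_Choice.inv u y"] by (intro image_eqI[of _ _ "Hilbert_Choice.inv u y"]) auto
  next
    fix y assume "y \<in> u ` {x \<in> {1..j}. u x \<le> i}"
    then obtain x where "y = u x" "x \<in> {1..j}" "u x \<le> i" by blast
    then show "y \<in> {y \<in> {1..i}. Hilbert_Choice.inv u y \<le> j}"
      using zero[of x] by (simp add: permutes_inverses(2)[OF u] Suc_le_eq)
  qed
  moreover have "inj_on u {x \<in> {1..j}. u x \<le> i}"
    using permutes_inj[OF u] by (rule inj_on_subset) simp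
  ultimately show ?thesis
    unfolding perm_rank_def using card_image by fastforce
qed

lemma rank_le_inv:
  assumes "u permutes {1..n}" "v permutes {1..n}"
  shows "rank_le n (Hilbert_Choice.inv u) (Hilbert_Choice.inv v) \<longleftrightarrow> rank_le n u v"
  unfolding rank_le_def perm_rank_inv[OF assms(1)] perm_rank_inv[OF assms(2)] by blast

abbreviation reversal :: "nat \<Rightarrow> nat \<Rightarrow> nat" where
  "reversal n \<equiv> mat_perm (antidiag_mat n)"

lemma reversal_permutes: "reversal n permutes {1..n}"
  by (rule mat_perm_permutes[OF permutation_mat_antidiag])

lemma inv_reversal: "Hilbert_Choice.inv (reversal n) = reversal n"
proof (rule inv_unique_comp)
  show "reversal n \<circ> reversal n = id"
  proof
    fix k show "(reversal n \<circ> reversal n) k = id k"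
    proof (cases "k \<in> {1..n}")
      case True
      then have "n + 1 - k \<in> {1..n}" by auto
      then show ?thesis using True by (simp add: mat_perm_antidiag)
    next
      case False
      then show ?thesis using permutes_not_in[OF reversal_permutes] by simp
    qed
  qed
  then show "reversal n \<circ> reversal n = id" .
qed

text \<open>On \<open>{1..n}\<close> the condition \<open>n + 1 - u x \<le> j\<close> is the
  negation of \<open>u x \<le> n - j\<close>, so the two counts partition
  \<open>{1..i}\<close>.\<close>

lemma perm_rank_reversal_comp:
  assumes u: "u permutes {1..n}" and "i \<le> n" "j \<le> n"
  shows "perm_rank (reversal n \<circ> u) i j + perm_rank u i (n - j) = i"
proof -
  have "(reversal n \<circ> u) x \<le> j \<longleftrightarrow> \<not> u x \<le> n - j" if "x \<in> {1..i}" for x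
  proof -
    have "u x \<in> {1..n}" unfolding permutes_in_image[OF u] using that assms by simp
    then show ?thesis using assms by (auto simp: mat_perm_antidiag)
  qed
  then have "perm_rank (reversal n \<circ> u) i j = card {x \<in> {1..i}. \<not> u x \<le> n - j}"
    unfolding perm_rank_def by (intro arg_cong[of _ _ card]) blast
  moreover have "card {x \<in> {1..i}. \<not> u x \<le> n - j} + perm_rank u i (n - j)
      = card ({x \<in> {1..i}. \<not> u x \<le> n - j} \<union> {x \<in> {1..i}. u x \<le> n - j})"
    unfolding perm_rank_def by (intro card_Un_disjoint[symmetric]) auto
  moreover have "{x \<in> {1..i}. \<not> u x \<le> n - j} \<union> {x \<in> {1..i}. u x \<le> n - j} = {1..i}"
    by blast
  ultimately show ?thesis by simp
qed

lemma rank_le_reversal_comp: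
  assumes u: "u permutes {1..n}" and v: "v permutes {1..n}"
  shows "rank_le n (reversal n \<circ> u) (reversal n \<circ> v) \<longleftrightarrow> rank_le n v u"
proof -
  have "perm_rank (reversal n \<circ> v) i j \<le> perm_rank (reversal n \<circ> u) i j
      \<longleftrightarrow> perm_rank u i (n - j) \<le> perm_rank v i (n - j)" if "i \<le> n" "j \<le> n" for i j
    using perm_rank_reversal_comp[OF u that] perm_rank_reversal_comp[OF v that] by linarith
  then have "rank_le n (reversal n \<circ> u) (reversal n \<circ> v)
      \<longleftrightarrow> (\<forall>i\<le>n. \<forall>j\<le>n. perm_rank u i (n - j) \<le> perm_rank v i (n - j))"
    unfolding rank_le_def by blast
  \<comment> \<open>\<open>j \<mapsto> n - j\<close> is an involution of the columns from 0 to
    \<open>n\<close>.\<close>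
  also have "\<dots> \<longleftrightarrow> rank_le n v u"
    unfolding rank_le_def by (metis diff_diff_cancel diff_le_self)
  finally show ?thesis .
qed

text \<open>Inversion turns composition with the reversal on the right into composition on the left,
  and it preserves \<open>rank_le\<close>.\<close>

lemma rank_le_comp_reversal:
  assumes u: "u permutes {1..n}" and v: "v permutes {1..n}"
  shows "rank_le n (u \<circ> reversal n) (v \<circ> reversal n) \<longleftrightarrow> rank_le n v u"
proof -
  have inv_comp: "Hilbert_Choice.inv (w \<circ> reversal n) = reversal n \<circ> Hilbert_Choice.inv w" if "w permutes {1..n}" for w
    using that reversal_permutes[of n]
    by (simp add: o_inv_distrib permutes_bij inv_reversal)
  have "rank_le n (u \<circ> reversal n) (v \<circ> reversal n)
      \<longleftrightarrow> rank_le n (Hilbert_Choice.inv (u \<circ> reversal n)) (Hilbert_Choice.inv (v \<circ> reversal n))"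
    using u v reversal_permutes[of n] by (simp add: rank_le_inv permutes_compose)
  also have "\<dots> \<longleftrightarrow> rank_le n (Hilbert_Choice.inv v) (Hilbert_Choice.inv u)"
    using u v by (simp add: inv_comp rank_le_reversal_comp permutes_inv)
  also have "\<dots> \<longleftrightarrow> rank_le n v u"
    using u v by (simp add: rank_le_inv)
  finally show ?thesis .
qed

section \<open>Matrices of permutations and their Jury products\<close>

text \<open>A relation rather than \<open>mat_perm\<close>, so that products and transposes receive
  their permutations by a computation of entries. \<open>Suc\<close> translates matrix indices from
  0 into positions from 1.\<close>

definition represents :: "nat \<Rightarrow> complex mat \<Rightarrow> (nat \<Rightarrow> nat) \<Rightarrow> bool" where
  "represents n M w \<longleftrightarrow> M \<in> carrier_mat n n \<and> w permutes {1..n}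
     \<and> (\<forall>i<n. \<forall>j<n. M $$ (i, j) = (if w (Suc i) = Suc j then 1 else 0))"

lemma represents_mat_perm:
  assumes "permutation_mat n P"
  shows "represents n P (mat_perm P)"
  unfolding represents_def
proof (intro conjI allI impI)
  show "P \<in> carrier_mat n n"
    using assms by (simp add: permutation_mat_def)
  show "P $$ (i, j) = (if mat_perm P (Suc i) = Suc j then 1 else 0)" if "i < n" "j < n" for i j
    using mat_perm_iff[OF assms that] assms that by (auto simp: permutation_mat_def)
qed (rule mat_perm_permutes[OF assms])

lemma permutes_SucE:
  assumes "w permutes {1..n}" "i < n"
  obtains k where "k < n" "w (Suc i) = Suc k"
proof -
  have "w (Suc i) \<in> {1..n}" unfolding permutes_in_image[OF assms(1)] using assms(2) by simp
  then show ?thesis using that[of "w (Suc i) - 1"] by auto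
qed

text \<open>With the row convention \<open>M\<^bsub>i, w i\<^esub> = 1\<close>, the order of the factors is reversed.\<close>

lemma represents_mult:
  assumes M: "represents n M u" and N: "represents n N v"
  shows "represents n (M * N) (v \<circ> u)"
proof -
  have c: "M \<in> carrier_mat n n" "N \<in> carrier_mat n n"
    and p: "u permutes {1..n}" "v permutes {1..n}"
    using M N by (auto simp: represents_def)
  have "(M * N) $$ (i, j) = (if (v \<circ> u) (Suc i) = Suc j then 1 else 0)" if ij: "i < n" "j < n" for i j
  proof -
    obtain k where k: "k < n" "u (Suc i) = Suc k"
      using permutes_SucE[OF p(1) ij(1)] .
    have "(M * N) $$ (i, j) = (\<Sum>l\<in>{0..<n}. M $$ (i, l) * N $$ (l, j))"
      using c ij by (auto simp: scalar_prod_def)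
    also have "\<dots> = (\<Sum>l\<in>{0..<n}. if l = k then N $$ (l, j) else 0)"
      using M ij k by (intro sum.cong) (auto simp: represents_def)
    also have "\<dots> = N $$ (k, j)" using k by simp
    also have "\<dots> = (if v (Suc k) = Suc j then 1 else 0)"
      using N ij k by (simp add: represents_def)
    finally show ?thesis using k by simp
  qed
  then show ?thesis
    unfolding represents_def using c permutes_compose[OF p] by auto
qed

lemma represents_transpose:
  assumes M: "represents n M u"
  shows "represents n (transpose_mat M) (Hilbert_Choice.inv u)"
proof -
  have c: "M \<in> carrier_mat n n" and p: "u permutes {1..n}"
    using M by (auto simp: represents_def)
  have "Hilbert_Choice.inv u (Suc i) = Suc j \<longleftrightarrow> u (Suc j) = Suc i" for i j
    using permutes_inv_eq[OF p] .
  then show ?thesis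
    using M c permutes_inv[OF p] unfolding represents_def by auto
qed

text \<open>Convolving with ones sums the upper left block of \<open>M\<close> ending at
  \<open>(i, j)\<close>. Each row has a single 1, and it contributes exactly if its column is at
  most \<open>j\<close>.\<close>

lemma jury_product_ones_entry:
  assumes M: "represents n M w" and ij: "i < n" "j < n"
  shows "(M \<diamondop> ones_mat n) $$ (i, j) = of_nat (perm_rank w (Suc i) (Suc j))"
proof -
  have c: "M \<in> carrier_mat n n" and p: "w permutes {1..n}"
    using M by (auto simp: represents_def)
  have row: "(\<Sum>k\<le>j. M $$ (l, k)) = (if w (Suc l) \<le> Suc j then 1 else 0)" if l: "l < n" for l
  proof -
    obtain m where m: "m < n" "w (Suc l) = Suc m"
      using permutes_SucE[OF p l] .
    have "(\<Sum>k\<le>j. M $$ (l, k)) = (\<Sum>k\<le>j. if k = m then 1 else 0)"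
      using M l ij m by (intro sum.cong) (auto simp: represents_def)
    then show ?thesis using m by simp
  qed
  have "(M \<diamondop> ones_mat n) $$ (i, j) = (\<Sum>l\<le>i. \<Sum>k\<le>j. M $$ (l, k) * ones_mat n $$ (i - l, j - k))"
    using c ij by (simp add: jury_product_def)
  also have "\<dots> = (\<Sum>l\<le>i. \<Sum>k\<le>j. M $$ (l, k))"
    using ij by (intro sum.cong) (auto simp: ones_mat_def)
  also have "\<dots> = (\<Sum>l\<le>i. if w (Suc l) \<le> Suc j then 1 else 0)"
    using row ij by (intro sum.cong) auto
  also have "\<dots> = of_nat (card {l \<in> {..i}. w (Suc l) \<le> Suc j})"
    by (simp add: sum.If_cases Int_def)
  also have "card {l \<in> {..i}. w (Suc l) \<le> Suc j} = card (Suc ` {l \<in> {..i}. w (Suc l) \<le> Suc j})"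
    by (simp add: card_image)
  also have "Suc ` {l \<in> {..i}. w (Suc l) \<le> Suc j} = {x \<in> {1..Suc i}. w x \<le> Suc j}"
    by (auto simp: image_iff Suc_le_eq gr0_conv_Suc)
  finally show ?thesis unfolding perm_rank_def .
qed

text \<open>Supplies the border that \<open>rank_le\<close> inspects but the matrix entries do not
  record. The column case is the row case for the inverse.\<close>

lemma perm_rank_0:
  assumes "u permutes {1..n}"
  shows "perm_rank u 0 j = 0" "perm_rank u i 0 = 0"
proof -
  show "perm_rank u 0 j = 0" for u j by (simp add: perm_rank_def)
  then have "perm_rank (Hilbert_Choice.inv u) 0 i = 0" .
  then show "perm_rank u i 0 = 0" by (simp add: perm_rank_inv[OF assms])
qed

lemma jury_product_ones_le_iff:
  assumes M: "represents n M u" and N: "represents n N v"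
  shows "M \<diamondop> ones_mat n \<le> N \<diamondop> ones_mat n \<longleftrightarrow> rank_le n v u"
proof -
  have c: "M \<in> carrier_mat n n" "N \<in> carrier_mat n n"
    and p: "u permutes {1..n}" "v permutes {1..n}"
    using M N by (auto simp: represents_def)
  have "M \<diamondop> ones_mat n \<le> N \<diamondop> ones_mat n
      \<longleftrightarrow> (\<forall>i<n. \<forall>j<n. (M \<diamondop> ones_mat n) $$ (i, j) \<le> (N \<diamondop> ones_mat n) $$ (i, j))"
    using c by (auto simp: less_eq_mat_def jury_product_def)
  \<comment> \<open>All entries are natural numbers, on which the complex order is the usual
    one.\<close>
  also have "\<dots> \<longleftrightarrow> (\<forall>i<n. \<forall>j<n. perm_rank u (Suc i) (Suc j) \<le> perm_rank v (Suc i) (Suc j))"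
    by (simp add: jury_product_ones_entry[OF M] jury_product_ones_entry[OF N] less_eq_complex_def)
  also have "\<dots> \<longleftrightarrow> rank_le n v u"
  proof -
    have "perm_rank u i j \<le> perm_rank v i j"
      if "\<forall>i<n. \<forall>j<n. perm_rank u (Suc i) (Suc j) \<le> perm_rank v (Suc i) (Suc j)" "i \<le> n" "j \<le> n" for i j
      using that by (cases i; cases j) (auto simp: perm_rank_0[OF p(1)])
    then show ?thesis unfolding rank_le_def by (auto simp: Suc_le_eq)
  qed
  finally show ?thesis .
qed

theorem theorem3p7:
  fixes n :: nat and P Q :: "complex mat"
  assumes "n \<ge> 1"
    and "invertible_mat P" and "permutation_mat n P"
    and "invertible_mat Q" and "permutation_mat n Q"
  shows "all_equivalent
    [bruhat_le n (mat_perm Q) (mat_perm P),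
     P \<diamondop> ones_mat n \<le> Q \<diamondop> ones_mat n,
     bruhat_le n (mat_perm (antidiag_mat n) \<circ> mat_perm P) (mat_perm (antidiag_mat n) \<circ> mat_perm Q),
     (antidiag_mat n * Q) \<diamondop> ones_mat n \<le> (antidiag_mat n * P) \<diamondop> ones_mat n,
     bruhat_le n (mat_perm P \<circ> mat_perm (antidiag_mat n)) (mat_perm Q \<circ> mat_perm (antidiag_mat n)),
     (Q * antidiag_mat n) \<diamondop> ones_mat n \<le> (P * antidiag_mat n) \<diamondop> ones_mat n,
     bruhat_le n (Hilbert_Choice.inv (mat_perm Q)) (Hilbert_Choice.inv (mat_perm P)),
     transpose_mat P \<diamondop> ones_mat n \<le> transpose_mat Q \<diamondop> ones_mat n]"
proof -
  note rep = represents_mat_perm[OF assms(3)] represents_mat_perm[OF assms(5)]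
    represents_mat_perm[OF permutation_mat_antidiag[of n]]
  note perms = mat_perm_permutes[OF assms(3)] mat_perm_permutes[OF assms(5)] reversal_permutes[of n]
  note reversed_perms = permutes_compose[OF perms(1) perms(3)] permutes_compose[OF perms(2) perms(3)]
    permutes_compose[OF perms(3) perms(1)] permutes_compose[OF perms(3) perms(2)]
  note bruhat = bruhat_le_iff_rank_le[OF perms(2) perms(1)]
    bruhat_le_iff_rank_le[OF reversed_perms(1) reversed_perms(2)]
    bruhat_le_iff_rank_le[OF reversed_perms(3) reversed_perms(4)]
    bruhat_le_iff_rank_le[OF permutes_inv[OF perms(2)] permutes_inv[OF perms(1)]]
  \<comment> \<open>Since \<open>represents_mult\<close> reverses factors,
    \<open>antidiag_mat n * Q\<close> belongs to \<open>mat_perm Q \<circ> reversal n\<close>. Thus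
    the fourth relation acquires the rank form of the fifth, and the sixth that of the
    third.\<close>
  note jury = jury_product_ones_le_iff[OF rep(1) rep(2)]
    jury_product_ones_le_iff[OF represents_mult[OF rep(3) rep(2)] represents_mult[OF rep(3) rep(1)]]
    jury_product_ones_le_iff[OF represents_mult[OF rep(2) rep(3)] represents_mult[OF rep(1) rep(3)]]
    jury_product_ones_le_iff[OF represents_transpose[OF rep(1)] represents_transpose[OF rep(2)]]
  note symmetries = rank_le_reversal_comp[OF perms(1) perms(2)]
    rank_le_comp_reversal[OF perms(1) perms(2)] rank_le_inv[OF perms(2) perms(1)]
  \<comment> \<open>Every relation in the list has become
    \<open>rank_le n (mat_perm Q) (mat_perm P)\<close>.\<close>
  show ?thesis
    unfolding all_equivalent_def bruhat jury symmetries by simp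
qed

end
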